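(* Let $\alpha,\beta\in\mathbb{R}^{+}$, let $a_1,a_2,b_1$ be real numbers with $b_1\notin\{0,-1,-2,\dots\}$, and let $m\ge 1$ be an integer. The following hold as identities of formal power series in $u$: (i) $$D_u^m\big[{}_{{}_2F_1}E_{(\alpha,\beta)}(a_1,a_2;b_1;u)\big]=\frac{m!\,(a_1)_m(a_2)_m}{(b_1)_m}\;{}_{{}_3F_2}E_{(\alpha,m\alpha+\beta)}(a_1+m,a_2+m,m+1;\,b_1+m,1;\,u).$$ (ii) $$D_{\hat d_{(\alpha,\beta)}}^m\big[e^{u\,{}_2\hat\chi_1\hat d_{(\alpha,\beta)}}\Psi_0\Phi_0\big]=\frac{u^m(a_1)_m(a_2)_m}{(b_1)_m}\;{}_{{}_2F_1}E_{(\alpha,\beta)}(a_1+m,a_2+m;\,b_1+m;\,u).$$ (iii) $$\prod_{n=1}^{m}D_{{}_{n+1}\hat\chi_n}\big[e^{u\,{}_2\hat\chi_1\hat d_{(\alpha,\beta)}}\Psi_0\Phi_0\big]=u^m\;{}_{{}_{m+2}F_{m+1}}E_{(\alpha,m\alpha+\beta)}(a_1,a_2,\underbrace{2,\dots,2}_{m};\,b_1,\underbrace{1,\dots,1}_{m};\,u).$$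
   Context: $(a)_r=a(a+1)\cdots(a+r-1)$, $(a)_0=1$. The generalized hypergeometric-Mittag-Leffler function is the formal power series $${}_{{}_pF_q}E_{(\alpha,\beta)}(A_1,\dots,A_p;B_1,\dots,B_q;u)=\sum_{r=0}^{\infty}\frac{(A_1)_r\cdots(A_p)_r}{(B_1)_r\cdots(B_q)_r}\,\frac{u^r}{\Gamma(\alpha r+\beta)} .$$ $D_u=d/du$. Umbral notation: ${}_p\hat\chi_q$ (attached to a list of parameters $A_1,\dots,A_p;B_1,\dots,B_q$) and $\hat d_{(\alpha,\beta)}$ are commuting formal symbols. A formal power series in $u$ whose coefficients are polynomials in these symbols is evaluated on the "vacua" linearly and coefficientwise in $u$, replacing ${}_p\hat\chi_q^{\,i}\,\hat d_{(\alpha,\beta)}^{\,j}\,\Psi_0\Phi_0$ by $\frac{(A_1)_i\cdots(A_p)_i}{(B_1)_i\cdots(B_q)_i}\cdot\frac{\Gamma(j+1)}{\Gamma(\alpha j+\beta)}$. Thus $${}_{{}_pF_q}E_{(\alpha,\beta)}(A_1,\dots,A_p;B_1,\dots,B_q;u)=e^{u\,{}_p\hat\chi_q\,\hat d_{(\alpha,\beta)}}\Psi_0\Phi_0;$$ ${}_2\hat\chi_1$ is attached to the parameters $a_1,a_2;b_1$. In (ii), $D_{\hat d_{(\alpha,\beta)}}^m$ means: differentiate the formal series $e^{u\,{}_2\hat\chi_1\hat d_{(\alpha,\beta)}}$ $m$ times with respect to the symbol $\hat d_{(\alpha,\beta)}$ and then evaluate on $\Psi_0\Phi_0$. In (iii),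 the product of derivatives is applied successively for $n=1,2,\dots,m$: at the $n$-th step one has a series $u^{n-1}\,{}_{{}_{n+1}F_n}E_{(\alpha,(n-1)\alpha+\beta)}(a_1,a_2,2,\dots,2;b_1,1,\dots,1;u)$ (with $n-1$ twos and $n-1$ ones), written in umbral form as $u^{n-1}e^{u\,{}_{n+1}\hat\chi_n\,\hat d_{(\alpha,(n-1)\alpha+\beta)}}\Psi_0\Phi_0$ where ${}_{n+1}\hat\chi_n$ is attached to these parameters; one differentiates $u^{n-1}e^{u\,{}_{n+1}\hat\chi_n\,\hat d_{(\alpha,(n-1)\alpha+\beta)}}$ once with respect to the symbol ${}_{n+1}\hat\chi_n$ and evaluates on $\Psi_0\Phi_0$. *)

theory Defs
  imports "HOL-Analysis.Gamma_Function"
    "HOL-Computational_Algebra.Polynomial"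
    "HOL-Computational_Algebra.Formal_Power_Series"
begin

definition poch_quot :: "real list \<Rightarrow> real list \<Rightarrow> nat \<Rightarrow> real" where
  "poch_quot As Bs r =
     prod_list (map (\<lambda>A. pochhammer A r) As) / prod_list (map (\<lambda>B. pochhammer B r) Bs)"

definition hyp_ML :: "real list \<Rightarrow> real list \<Rightarrow> real \<Rightarrow> real \<Rightarrow> real fps" where
  "hyp_ML As Bs \<alpha> \<beta> = Abs_fps (\<lambda>r. poch_quot As Bs r * (1 / Gamma (\<alpha> * real r + \<beta>)))"

text \<open>
  Polynomials in the two commuting umbral symbols are represented as polynomials in the symbol
  \<open>d\<close> whose coefficients are polynomials in the symbol \<open>\<chi>\<close>: the coefficient of
  \<open>\<chi>\<^sup>i d\<^sup>j\<close> in \<open>p\<close> is \<open>coeff (coeff p j) i\<close>. The symbols themselves carry no parameters;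
  the parameters enter only through the evaluation on the vacua.
\<close>

type_synonym umbral = "real poly poly"

definition chi_sym :: umbral where
  "chi_sym = [:[:0, 1:]:]"

definition d_sym :: umbral where
  "d_sym = [:0, 1:]"

definition umbral_exp :: "umbral fps" where \<comment> \<open>\<open>e\<^bsup>u \<chi> d\<^esup>\<close>\<close>
  "umbral_exp = Abs_fps (\<lambda>r. smult [:1 / fact r:] ((chi_sym * d_sym) ^ r))"

definition D_d :: "umbral fps \<Rightarrow> umbral fps" where
  "D_d F = Abs_fps (\<lambda>r. pderiv (fps_nth F r))"

definition D_chi :: "umbral fps \<Rightarrow> umbral fps" where
  "D_chi F = Abs_fps (\<lambda>r. map_poly pderiv (fps_nth F r))"

definition vac_poly :: "real list \<Rightarrow> real list \<Rightarrow> real \<Rightarrow> real \<Rightarrow> umbral \<Rightarrow> real" where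
  "vac_poly As Bs \<alpha> \<beta> p =
     (\<Sum>j\<le>degree p. \<Sum>i\<le>degree (coeff p j).
        coeff (coeff p j) i *
        (poch_quot As Bs i * (Gamma (real j + 1) / Gamma (\<alpha> * real j + \<beta>))))"

definition vac :: "real list \<Rightarrow> real list \<Rightarrow> real \<Rightarrow> real \<Rightarrow> umbral fps \<Rightarrow> real fps" where
  "vac As Bs \<alpha> \<beta> F = Abs_fps (\<lambda>r. vac_poly As Bs \<alpha> \<beta> (fps_nth F r))"

text \<open>
  Differentiation with respect to the symbol \<open>\<^bsub>n+1\<^esub>\<chi>\<^bsub>n\<^esub>\<close>, for \<open>n \<ge> 1\<close>, as a partial operator on
  series in \<open>u\<close>. It depends on an umbral form of its argument, so it is defined only at the series
  whose umbral form is \<open>u\<^bsup>n-1\<^esup> e\<^bsup>u \<chi> d\<^esup>\<close> for the parameters belonging to \<open>n\<close>.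
\<close>

definition D_chi_step ::
    "real \<Rightarrow> real \<Rightarrow> real \<Rightarrow> real \<Rightarrow> real \<Rightarrow> nat \<Rightarrow> real fps \<Rightarrow> real fps option" where
  "D_chi_step a1 a2 b1 \<alpha> \<beta> n f =
     (let As = [a1, a2] @ replicate (n - 1) 2;
          Bs = [b1] @ replicate (n - 1) 1;
          \<beta>' = real (n - 1) * \<alpha> + \<beta>;
          F = fps_X ^ (n - 1) * umbral_exp
      in if f = fps_X ^ (n - 1) * hyp_ML As Bs \<alpha> \<beta>' \<and> f = vac As Bs \<alpha> \<beta>' F
         then Some (vac As Bs \<alpha> \<beta>' (D_chi F))
         else None)"

text \<open>
  The factors are applied in the order \<open>n = 1, \<dots>, m\<close>, each to the result of the preceding one;
  the value is \<open>None\<close> if some factor is not applicable.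
\<close>

primrec D_chi_prod ::
    "real \<Rightarrow> real \<Rightarrow> real \<Rightarrow> real \<Rightarrow> real \<Rightarrow> nat \<Rightarrow> real fps \<Rightarrow> real fps option" where
  "D_chi_prod a1 a2 b1 \<alpha> \<beta> 0 f = Some f"
| "D_chi_prod a1 a2 b1 \<alpha> \<beta> (Suc n) f =
     Option.bind (D_chi_prod a1 a2 b1 \<alpha> \<beta> n f) (D_chi_step a1 a2 b1 \<alpha> \<beta> (Suc n))"

end

theory Submission
  imports Defs
begin

text \<open>
  The coefficient of \<open>u\<^sup>r\<close> in \<open>e\<^bsup>u \<chi> d\<^esup>\<close> is the monomial \<open>\<chi>\<^sup>r d\<^sup>r / r!\<close>, on which the vacuum evaluation
  cancels \<open>r!\<close> against \<open>Gamma (r + 1)\<close>. Differentiation in a symbol lowers only that symbol's exponent,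
  so each identity reduces to comparing coefficients: (i) and (ii) by
  \<open>(A)\<^bsub>m+r\<^esub> = (A)\<^sub>m (A+m)\<^sub>r\<close>, and (iii) because the factor \<open>s + 1\<close> left over by
  each derivative in \<open>\<chi>\<close> equals \<open>(2)\<^sub>s / (1)\<^sub>s\<close>.
\<close>

lemma vac_poly_0 [simp]: "vac_poly As Bs \<alpha> \<beta> 0 = 0"
  by (simp add: vac_poly_def)

lemma vac_poly_monom:
  "vac_poly As Bs \<alpha> \<beta> (monom (monom c i) j) =
     c * (poch_quot As Bs i * (fact j / Gamma (\<alpha> * real j + \<beta>)))"
proof (cases "c = 0")
  case False
  \<comment> \<open>For nonzero \<open>c\<close> the degree bounding each sum is the exponent
    itself, so only the last term survives.\<close>
  have delta: "(\<Sum>k\<le>n. (if n = k then c else 0) * h k) = c * h n" for n and h :: "nat \<Rightarrow> real"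
    by (simp add: if_distrib [of "\<lambda>x. x * _"] cong: if_cong)
  let ?g = "\<lambda>j. Gamma (real j + 1) / Gamma (\<alpha> * real j + \<beta>)"
  have row: "(\<Sum>k\<le>degree (coeff (monom (monom c i) j) l).
        coeff (coeff (monom (monom c i) j) l) k * (poch_quot As Bs k * ?g l)) =
      (if l = j then c * (poch_quot As Bs i * ?g j) else 0)" for l
    using False by (simp add: degree_monom_eq delta del: times_divide_eq_right)
  have "vac_poly As Bs \<alpha> \<beta> (monom (monom c i) j) =
      (\<Sum>l\<le>j. if l = j then c * (poch_quot As Bs i * ?g j) else 0)"
    unfolding vac_poly_def row using False by (simp add: degree_monom_eq)
  then show ?thesis
    by (simp add: Gamma_fact add.commute)
qed simp

lemma umbral_exp_nth: "fps_nth umbral_exp r = monom (monom (1 / fact r) r) r"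
proof -
  have "chi_sym * d_sym = monom (monom 1 1) 1"
    by (simp add: chi_sym_def d_sym_def monom_altdef)
  then have "(chi_sym * d_sym) ^ r = monom (monom 1 r) r"
    by (simp add: monom_power)
  then show ?thesis
    by (simp add: umbral_exp_def smult_monom)
qed

lemma D_d_funpow_umbral_exp_nth:
  "fps_nth ((D_d ^^ m) umbral_exp) r =
     (if r < m then 0 else monom (monom (1 / fact (r - m)) r) (r - m))"
proof (induction m arbitrary: r)
  case 0
  then show ?case by (simp add: umbral_exp_nth)
next
  case (Suc m)
  have step: "pderiv (monom (monom (1 / fact (Suc k)) r) (Suc k)) = monom (monom (1 / fact k :: real) r) k"
    for k :: nat and r :: nat
    by (simp add: pderiv_monom of_nat_poly smult_monom del: of_nat_Suc)
  \<comment> \<open>At \<open>r = m\<close> the power of \<open>d\<close> is used up: the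
    coefficient is constant in \<open>d\<close> and one more derivative kills it.\<close>
  consider "r < m" | "r = m" | k where "r = m + Suc k"
    by (metis less_imp_Suc_add linorder_neqE_nat add_Suc_right)
  then show ?case
  proof cases
    case 3
    then have "r - m = Suc k" "r - Suc m = k" "\<not> r < m" "\<not> r < Suc m" by auto
    then show ?thesis
      by (simp add: D_d_def [of "(D_d ^^ m) umbral_exp"] Suc step del: fact_Suc of_nat_Suc)
  qed (simp_all add: D_d_def [of "(D_d ^^ m) umbral_exp"] Suc pderiv_monom)
qed

text \<open>At \<open>r = n\<close> the factor \<open>real (r - n)\<close> is 0, so the truncated
  exponent \<open>r - n - 1\<close> does no harm.\<close>

lemma D_chi_umbral_exp_nth:
  "fps_nth (D_chi (fps_X ^ n * umbral_exp)) r =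
     (if r < n then 0 else monom (monom (real (r - n) / fact (r - n)) (r - n - 1)) (r - n))"
  by (simp add: D_chi_def fps_X_power_mult_nth umbral_exp_nth map_poly_monom pderiv_monom)

text \<open>This is the agreement of a series with its umbral form that \<open>D_chi_step\<close>
  demands of its argument.\<close>

lemma vac_fps_X_power_mult_umbral_exp:
  "vac As Bs \<alpha> \<beta> (fps_X ^ n * umbral_exp) = fps_X ^ n * hyp_ML As Bs \<alpha> \<beta>"
  by (rule fps_ext)
    (simp add: vac_def hyp_ML_def fps_X_power_mult_nth umbral_exp_nth vac_poly_monom)

lemma pochhammer_2: "pochhammer (2 :: real) s = fact s * (real s + 1)"
  \<comment> \<open>Splitting the first factor off \<open>(1)_(s+1) = (s+1)!\<close> leaves
    \<open>(2)_s\<close>.\<close>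
  using pochhammer_fact [of "Suc s", where ?'a = real] by (simp add: pochhammer_rec algebra_simps)

lemma poch_quot_append_2_1:
  "poch_quot (As @ [2]) (Bs @ [1]) s = (real s + 1) * poch_quot As Bs s"
  by (simp add: poch_quot_def pochhammer_2 flip: pochhammer_fact)

text \<open>The derivative leaves \<open>\<chi>^s d^(s+1)\<close>: the surplus power of
  \<open>d\<close> shifts \<beta> by \<alpha>, and the factor \<open>s + 1\<close> becomes the new
  parameter pair 2; 1.\<close>

lemma vac_D_chi_umbral_exp:
  "vac As Bs \<alpha> \<beta> (D_chi (fps_X ^ n * umbral_exp)) =
     fps_X ^ Suc n * hyp_ML (As @ [2]) (Bs @ [1]) \<alpha> (\<alpha> + \<beta>)"
proof (rule fps_ext)
  fix r
  \<comment> \<open>The lowest term, at \<open>r = n\<close>, is free of \<open>\<chi>\<close> and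
    vanishes; hence the extra power of \<open>u\<close>.\<close>
  consider "r < n" | "r = n" | s where "r = n + Suc s"
    by (metis less_imp_Suc_add linorder_neqE_nat add_Suc_right)
  then show "fps_nth (vac As Bs \<alpha> \<beta> (D_chi (fps_X ^ n * umbral_exp))) r =
      fps_nth (fps_X ^ Suc n * hyp_ML (As @ [2]) (Bs @ [1]) \<alpha> (\<alpha> + \<beta>)) r"
  proof cases
    case 3
    then have "r - n = Suc s" "r - Suc n = s" "\<not> r < n" "\<not> r < Suc n" by auto
    moreover have "\<alpha> * real (Suc s) + \<beta> = \<alpha> * real s + (\<alpha> + \<beta>)"
      by (simp add: algebra_simps)
    ultimately show ?thesis
      by (simp add: vac_def hyp_ML_def D_chi_umbral_exp_nth fps_X_power_mult_nth vac_poly_monom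
          poch_quot_append_2_1 add_ac del: power_Suc fact_Suc)
  qed (simp_all add: vac_def D_chi_umbral_exp_nth fps_X_power_mult_nth vac_poly_monom
          del: power_Suc)
qed

lemma poch_quot_add:
  "poch_quot As Bs (m + r) =
     poch_quot As Bs m * poch_quot (map (\<lambda>A. A + real m) As) (map (\<lambda>B. B + real m) Bs) r"
proof -
  have "prod_list (map (\<lambda>A. pochhammer A (m + r)) Cs) =
      prod_list (map (\<lambda>A. pochhammer A m) Cs) *
      prod_list (map (\<lambda>A. pochhammer A r) (map (\<lambda>A. A + real m) Cs))" for Cs :: "real list"
    by (induction Cs) (simp_all add: pochhammer_product')
  then show ?thesis by (simp add: poch_quot_def)
qed

text \<open>The factor is \<open>(r+m)!/r!\<close>, collected from \<open>m\<close> successive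
  exponents; the outermost derivative calls the induction hypothesis at
  \<open>r + 1\<close>.\<close>

lemma fps_deriv_funpow_nth:
  fixes f :: "real fps"
  shows "fps_nth ((fps_deriv ^^ m) f) r = pochhammer (real r + 1) m * fps_nth f (r + m)"
proof (induction m arbitrary: r)
  case (Suc m)
  then show ?case by (simp add: pochhammer_rec add_ac)
qed simp

text \<open>Both sides are \<open>(m+r)!\<close>. Thus \<open>(r+1)_m = m! (m+1)_r / (1)_r\<close>,
  the source of \<open>m!\<close> and of the parameters \<open>m+1\<close>; 1 in (i).\<close>

lemma fact_mult_pochhammer_Suc:
  "fact m * pochhammer (real m + 1) r = fact r * pochhammer (real r + 1) m"
  using pochhammer_product' [of "1 :: real" m r] pochhammer_product' [of "1 :: real" r m]
  by (simp add: add.commute flip: pochhammer_fact)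

lemma fps_deriv_funpow_hyp_ML:
  "(fps_deriv ^^ m) (hyp_ML As Bs \<alpha> \<beta>) =
     fps_const (fact m * poch_quot As Bs m) *
     hyp_ML (map (\<lambda>A. A + real m) As @ [real m + 1]) (map (\<lambda>B. B + real m) Bs @ [1])
       \<alpha> (real m * \<alpha> + \<beta>)"
proof (rule fps_ext)
  fix r
  let ?As = "map (\<lambda>A. A + real m) As" and ?Bs = "map (\<lambda>B. B + real m) Bs"
  have append: "fact m * poch_quot (?As @ [real m + 1]) (?Bs @ [1]) r =
      pochhammer (real r + 1) m * poch_quot ?As ?Bs r"
    using fact_mult_pochhammer_Suc [of m r]
    by (simp add: poch_quot_def pochhammer_fact [symmetric] divide_simps)
  have arg: "\<alpha> * real (r + m) + \<beta> = \<alpha> * real r + (real m * \<alpha> + \<beta>)"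
    by (simp add: algebra_simps)
  have "fps_nth ((fps_deriv ^^ m) (hyp_ML As Bs \<alpha> \<beta>)) r =
      poch_quot As Bs m * (pochhammer (real r + 1) m * poch_quot ?As ?Bs r) *
      (1 / Gamma (\<alpha> * real (r + m) + \<beta>))"
    by (simp add: fps_deriv_funpow_nth hyp_ML_def add.commute [of r m] poch_quot_add)
  then show "fps_nth ((fps_deriv ^^ m) (hyp_ML As Bs \<alpha> \<beta>)) r =
      fps_nth (fps_const (fact m * poch_quot As Bs m) *
        hyp_ML (?As @ [real m + 1]) (?Bs @ [1]) \<alpha> (real m * \<alpha> + \<beta>)) r"
    unfolding append [symmetric] arg by (simp add: hyp_ML_def)
qed

text \<open>The power of \<open>\<chi>\<close> stays \<open>r\<close>, which shifts the parameters
  by \<open>m\<close>; the power of \<open>d\<close> falls to \<open>r - m\<close>, whose factorial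
  cancels, so that \<beta> is unshifted and no parameter is added.\<close>

lemma vac_D_d_funpow_umbral_exp:
  "vac As Bs \<alpha> \<beta> ((D_d ^^ m) umbral_exp) =
     fps_X ^ m * fps_const (poch_quot As Bs m) *
     hyp_ML (map (\<lambda>A. A + real m) As) (map (\<lambda>B. B + real m) Bs) \<alpha> \<beta>"
proof (rule fps_ext)
  fix r
  show "fps_nth (vac As Bs \<alpha> \<beta> ((D_d ^^ m) umbral_exp)) r =
      fps_nth (fps_X ^ m * fps_const (poch_quot As Bs m) *
        hyp_ML (map (\<lambda>A. A + real m) As) (map (\<lambda>B. B + real m) Bs) \<alpha> \<beta>) r"
  proof (cases "r < m")
    case False
    then show ?thesis
      using poch_quot_add [of As Bs m "r - m"]
      by (simp add: vac_def D_d_funpow_umbral_exp_nth vac_poly_monom hyp_ML_def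
          fps_X_power_mult_nth mult.assoc)
  qed (simp add: vac_def D_d_funpow_umbral_exp_nth fps_X_power_mult_nth mult.assoc)
qed

text \<open>The value after \<open>m\<close> factors is exactly the series that factor
  \<open>m + 1\<close> accepts, so both guards hold at every stage and \<open>None\<close> never
  arises.\<close>

lemma D_chi_prod_umbral_exp:
  "D_chi_prod a1 a2 b1 \<alpha> \<beta> m (vac [a1, a2] [b1] \<alpha> \<beta> umbral_exp) =
     Some (fps_X ^ m *
       hyp_ML ([a1, a2] @ replicate m 2) ([b1] @ replicate m 1) \<alpha> (real m * \<alpha> + \<beta>))"
proof (induction m)
  case 0
  then show ?case
    using vac_fps_X_power_mult_umbral_exp [of "[a1, a2]" "[b1]" \<alpha> \<beta> 0] by simp
next
  case (Suc m)
  have "vac ([a1, a2] @ replicate m 2) ([b1] @ replicate m 1) \<alpha> (real m * \<alpha> + \<beta>)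
        (D_chi (fps_X ^ m * umbral_exp)) =
      fps_X ^ Suc m * hyp_ML ([a1, a2] @ replicate (Suc m) 2) ([b1] @ replicate (Suc m) 1)
        \<alpha> (real (Suc m) * \<alpha> + \<beta>)"
    \<comment> \<open>The new 2 and 1 arrive at the end of the lists, whereas
      \<open>replicate (Suc m)\<close> adds at the front.\<close>
    unfolding vac_D_chi_umbral_exp
    by (simp add: replicate_append_same algebra_simps del: power_Suc)
  then show ?case
    by (simp add: Suc D_chi_step_def vac_fps_X_power_mult_umbral_exp Let_def
        del: power_Suc replicate_Suc append.simps of_nat_Suc)
qed

theorem theorem4:
  fixes \<alpha> \<beta> a1 a2 b1 :: real and m :: nat
  assumes "\<alpha> > 0" and "\<beta> > 0"
    and "b1 \<notin> \<int>\<^sub>\<le>\<^sub>0"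
    and "m \<ge> 1"
  shows "(fps_deriv ^^ m) (hyp_ML [a1, a2] [b1] \<alpha> \<beta>) =
           fps_const (fact m * pochhammer a1 m * pochhammer a2 m / pochhammer b1 m) *
           hyp_ML [a1 + real m, a2 + real m, real m + 1] [b1 + real m, 1] \<alpha> (real m * \<alpha> + \<beta>)
       \<and> vac [a1, a2] [b1] \<alpha> \<beta> ((D_d ^^ m) umbral_exp) =
           fps_X ^ m * fps_const (pochhammer a1 m * pochhammer a2 m / pochhammer b1 m) *
           hyp_ML [a1 + real m, a2 + real m] [b1 + real m] \<alpha> \<beta>
       \<and> D_chi_prod a1 a2 b1 \<alpha> \<beta> m (vac [a1, a2] [b1] \<alpha> \<beta> umbral_exp) =
           Some (fps_X ^ m *
             hyp_ML ([a1, a2] @ replicate m 2) ([b1] @ replicate m 1) \<alpha> (real m * \<alpha> + \<beta>))"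
  using fps_deriv_funpow_hyp_ML [of m "[a1, a2]" "[b1]" \<alpha> \<beta>]
    vac_D_d_funpow_umbral_exp [of "[a1, a2]" "[b1]" \<alpha> \<beta> m]
    D_chi_prod_umbral_exp [of a1 a2 b1 \<alpha> \<beta> m]
  by (simp add: poch_quot_def mult.assoc)

end
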